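(* Let $\mathbb{T}^2$ be the $2$-torus and let $\tau:\mathbb{T}^2\to\mathbb{T}^2$ be a free involution that preserves orientation. If $\beta\in[\mathbb{T}^2,\mathbb{T}^2]$ is a (free) homotopy class of maps, then $\beta$ does not have the Borsuk-Ulam property with respect to $\tau$.
   Context: $[M,N]$ denotes the set of free homotopy classes of continuous maps $M\to N$. A free involution $\tau:M\to M$ is a continuous map with $\tau\circ\tau=\mathrm{id}$ and $\tau(x)\neq x$ for all $x\in M$. A homotopy class $\beta\in[M,N]$ has the Borsuk-Ulam property with respect to $\tau$ if for every continuous map $f:M\to N$ with $f\in\beta$ there exists $x\in M$ such that $f(\tau(x))=f(x)$. *)

theory Defs
  imports "HOL-Homology.Homology"
begin

definition torus :: "(complex \<times> complex) topology"
  where "torus = prod_topology (top_of_set (sphere 0 1)) (top_of_set (sphere 0 1))"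

definition homotopy_rel :: "'a topology \<Rightarrow> 'b topology \<Rightarrow> (('a \<Rightarrow> 'b) \<times> ('a \<Rightarrow> 'b)) set"
  where "homotopy_rel M N = {(f, g). homotopic_with (\<lambda>_. True) M N f g}"

(* [M, N].  HOL functions are total, so a class contains every extension of its maps to
   points outside topspace M; homotopic_with and the predicates below ignore those values. *)
definition homotopy_classes :: "'a topology \<Rightarrow> 'b topology \<Rightarrow> ('a \<Rightarrow> 'b) set set"
  where "homotopy_classes M N = {f. continuous_map M N f} // homotopy_rel M N"

definition free_involution :: "'a topology \<Rightarrow> ('a \<Rightarrow> 'a) \<Rightarrow> bool"
  where "free_involution M \<tau> \<longleftrightarrow>
    continuous_map M M \<tau> \<and> (\<forall>x\<in>topspace M. \<tau> (\<tau> x) = x \<and> \<tau> x \<noteq> x)"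

(* For M a closed connected orientable n-manifold, the integral homology group H_n(M) is
   infinite cyclic and its generators are the two fundamental classes (orientations) of M.
   A self-homeomorphism preserves orientation iff it fixes a fundamental class, that is,
   iff it induces the identity on H_n(M). *)
definition preserves_orientation :: "nat \<Rightarrow> 'a topology \<Rightarrow> ('a \<Rightarrow> 'a) \<Rightarrow> bool"
  where "preserves_orientation n M \<phi> \<longleftrightarrow>
    (\<forall>c\<in>carrier (homology_group (int n) M). hom_induced (int n) M {} M {} \<phi> c = c)"

definition Borsuk_Ulam_property ::
    "'a topology \<Rightarrow> 'b topology \<Rightarrow> ('a \<Rightarrow> 'a) \<Rightarrow> ('a \<Rightarrow> 'b) set \<Rightarrow> bool"
  where "Borsuk_Ulam_property M N \<tau> \<beta> \<longleftrightarrow>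
    (\<forall>f. continuous_map M N f \<and> f \<in> \<beta> \<longrightarrow> (\<exists>x\<in>topspace M. f (\<tau> x) = f x))"

end

theory Submission
  imports Defs "HOL-Analysis.Analysis"
begin

text \<open>
  Everything is computed on the universal cover \<open>torus_cover\<close>, the map from the plane \<open>\<complex>\<close> to the
  torus whose deck transformations are the translations by Gaussian integers. A self-map of the
  torus has a lift \<open>F\<close> to the plane with \<open>F (z + n) = F z + A n\<close> for an integral matrix \<open>A\<close>
  (\<open>torus_map_lift\<close>), and any two maps with the same \<open>A\<close> are homotopic, because the difference of
  their lifts is a map from the torus to the plane (\<open>torus_map_homotopic_translate\<close>). It is
  therefore enough to find, for each \<open>A\<close>, one lift \<open>G\<close> with matrix \<open>A\<close> such that \<open>G (T z) - G z\<close> is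
  never a Gaussian integer, where \<open>T\<close> is a lift of the involution.

  For an orientation-preserving free involution, \<open>T\<close> can be put in normal form
  (\<open>involution_lift\<close>): it commutes with deck translations, and \<open>T (T z) = z + v\<close> for a Gaussian
  integer \<open>v\<close> that is not divisible by 2. Two facts enter. The first is that the matrix of \<open>T\<close> has
  determinant 1 (\<open>orientation_preserving_det\<close>). The determinant is detected by an explicit singular
  cocycle, the cup product of the two coordinate 1-cocycles: it vanishes on boundaries, equals 1 on
  the square cut into two triangles, and equals the determinant on the image of that square.
  The second is that a continuous involution of the plane has a fixed point
  (\<open>plane_involution_fixed_point\<close>).

  In the averaged coordinate \<open>y z = (z + T z) / 2\<close> the involution is the translation by \<open>v / 2\<close>, so
  \<open>A (y z)\<close> changes by the constant \<open>A v / 2\<close>. This is already a solution unless the constant is a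
  Gaussian integer. To cover that case as well, a small function \<open>u / 8\<close> is added, where \<open>u\<close> is a
  map to the unit circle with \<open>u (T z) = - u z\<close>; it is \<open>exp (2 \<pi> \<i> t)\<close> for a coordinate \<open>t\<close> of \<open>y\<close> in
  which \<open>v\<close> is odd. The resulting difference \<open>A v / 2 - u z / 4\<close> is never a Gaussian integer.
\<close>

section \<open>The plane as universal cover of the torus\<close>

definition torus_cover :: "complex \<Rightarrow> complex \<times> complex"
  where "torus_cover z = (cis (2 * pi * Re z), cis (2 * pi * Im z))"

definition gauss_int :: "complex set"
  where "gauss_int = {z. Re z \<in> \<int> \<and> Im z \<in> \<int>}"

text \<open>The real-linear map sending \<open>1\<close> to \<open>a\<close> and \<open>\<i>\<close> to \<open>b\<close>. With \<open>a\<close> and \<open>b\<close> Gaussian integers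
it is an integral \<open>2 \<times> 2\<close> matrix, the form in which the action of a torus map on the fundamental
group appears below.\<close>
definition plane_linear :: "complex \<Rightarrow> complex \<Rightarrow> complex \<Rightarrow> complex"
  where "plane_linear a b z = Re z *\<^sub>R a + Im z *\<^sub>R b"

lemma gauss_int_simps [simp]:
  "0 \<in> gauss_int" "1 \<in> gauss_int" "\<i> \<in> gauss_int"
  by (auto simp: gauss_int_def)

lemma gauss_int_closed:
  assumes "m \<in> gauss_int" "n \<in> gauss_int"
  shows "m + n \<in> gauss_int" "m - n \<in> gauss_int"
  using assms by (auto simp: gauss_int_def)

lemma gauss_int_uminus: "m \<in> gauss_int \<Longrightarrow> - m \<in> gauss_int"
  by (simp add: gauss_int_def)

lemma plane_linear_gauss_int:
  "a \<in> gauss_int \<Longrightarrow> b \<in> gauss_int \<Longrightarrow> n \<in> gauss_int \<Longrightarrow> plane_linear a b n \<in> gauss_int"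
  by (auto simp: gauss_int_def plane_linear_def)

lemma plane_linear_add: "plane_linear a b (w + z) = plane_linear a b w + plane_linear a b z"
  and plane_linear_scaleR: "plane_linear a b (r *\<^sub>R z) = r *\<^sub>R plane_linear a b z"
  by (simp_all add: plane_linear_def algebra_simps)

lemma continuous_on_plane_linear [continuous_intros]:
  "continuous_on S g \<Longrightarrow> continuous_on S (\<lambda>x. plane_linear a b (g x))"
  unfolding plane_linear_def by (intro continuous_intros)

lemma torus_eq: "torus = top_of_set (sphere 0 1 \<times> sphere 0 1)"
  by (simp add: torus_def)

lemma topspace_torus: "topspace torus = sphere 0 1 \<times> sphere 0 1"
  by (simp add: torus_eq)

lemma torus_cover_in_torus [simp]: "torus_cover z \<in> topspace torus"
  by (simp add: topspace_torus torus_cover_def)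

lemma cis_eq_iff_Ints: "cis (2 * pi * x) = cis (2 * pi * y) \<longleftrightarrow> x - y \<in> \<int>"
proof
  assume "cis (2 * pi * x) = cis (2 * pi * y)"
  then obtain n :: int where "2 * pi * x = 2 * pi * y + 2 * pi * n"
    using sin_cos_eq_iff [of "2 * pi * x" "2 * pi * y"] by (auto simp: complex_eq_iff)
  then have "pi * x = pi * (y + n)" by (simp add: algebra_simps)
  then have "x - y = n" by simp
  then show "x - y \<in> \<int>" by simp
next
  assume "x - y \<in> \<int>"
  then have "cis (2 * pi * (x - y)) = 1" by (rule cis_multiple_2pi)
  then have "cis (2 * pi * x) / cis (2 * pi * y) = 1"
    by (simp add: cis_divide algebra_simps)
  then show "cis (2 * pi * x) = cis (2 * pi * y)" by simp
qed

lemma torus_cover_eq_iff: "torus_cover w = torus_cover z \<longleftrightarrow> w - z \<in> gauss_int"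
  by (simp add: torus_cover_def gauss_int_def cis_eq_iff_Ints)

lemma continuous_on_torus_cover [continuous_intros]:
  "continuous_on S g \<Longrightarrow> continuous_on S (\<lambda>x. torus_cover (g x))"
  unfolding torus_cover_def by (intro continuous_intros)

text \<open>A continuous logarithm of each of the two circle-valued components gives the two real
components of the lift.\<close>
lemma torus_cover_lift:
  fixes f :: "'a::real_normed_vector \<Rightarrow> complex \<times> complex"
  assumes "contractible S" "continuous_on S f" "f ` S \<subseteq> topspace torus"
  obtains g where "continuous_on S g" "\<And>x. x \<in> S \<Longrightarrow> torus_cover (g x) = f x"
proof -
  have circle: "\<exists>t. continuous_on S t \<and> (\<forall>x\<in>S. cis (2 * pi * t x) = h x)"
    if h: "continuous_on S h" "\<And>x. x \<in> S \<Longrightarrow> norm (h x) = 1" for h :: "'a \<Rightarrow> complex"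
  proof -
    have "h x \<noteq> 0" if "x \<in> S" for x using h(2)[OF that] by auto
    then obtain l where l: "continuous_on S l" "\<And>x. x \<in> S \<Longrightarrow> h x = exp (l x)"
      using continuous_logarithm_on_contractible [OF h(1) assms(1)] by metis
    have "cis (Im (l x)) = h x" if "x \<in> S" for x
    proof -
      have "exp (Re (l x)) = 1"
        using h(2)[OF that] l(2)[OF that] by (simp add: norm_exp_eq_Re)
      then show ?thesis using l(2)[OF that] by (simp add: exp_eq_polar)
    qed
    moreover have "continuous_on S (\<lambda>x. Im (l x) / (2 * pi))"
      by (intro continuous_intros l) simp
    ultimately show ?thesis
      by (intro exI [of _ "\<lambda>x. Im (l x) / (2 * pi)"]) simp
  qed
  have unit: "norm (fst (f x)) = 1" "norm (snd (f x)) = 1" if "x \<in> S" for x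
    using that assms(3) by (auto simp: topspace_torus image_subset_iff mem_Times_iff)
  obtain s where s: "continuous_on S s" "\<And>x. x \<in> S \<Longrightarrow> cis (2 * pi * s x) = fst (f x)"
    using circle [of "\<lambda>x. fst (f x)"] unit assms(2) continuous_on_fst by blast
  obtain t where t: "continuous_on S t" "\<And>x. x \<in> S \<Longrightarrow> cis (2 * pi * t x) = snd (f x)"
    using circle [of "\<lambda>x. snd (f x)"] unit assms(2) continuous_on_snd by blast
  show ?thesis
  proof
    show "continuous_on S (\<lambda>x. Complex (s x) (t x))"
      unfolding Complex_eq by (intro continuous_intros s t)
    show "torus_cover (Complex (s x) (t x)) = f x" if "x \<in> S" for x
      using s(2)[OF that] t(2)[OF that] by (simp add: torus_cover_def)
  qed
qed

lemma gauss_int_norm_ge_1: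
  assumes "n \<in> gauss_int" "n \<noteq> 0"
  shows "1 \<le> norm n"
proof -
  have "1 \<le> \<bar>Re n\<bar> \<or> 1 \<le> \<bar>Im n\<bar>"
    using assms Ints_nonzero_abs_ge1 by (fastforce simp: gauss_int_def complex_eq_iff)
  then show ?thesis
    using abs_Re_le_cmod [of n] abs_Im_le_cmod [of n] by linarith
qed

text \<open>Distinct Gaussian integers have distance at least 1, so a continuous function with such values
cannot jump.\<close>
lemma gauss_int_valued_constant:
  fixes g :: "'a::topological_space \<Rightarrow> complex"
  assumes "connected S" "continuous_on S g" "\<And>x. x \<in> S \<Longrightarrow> g x \<in> gauss_int" "x \<in> S" "y \<in> S"
  shows "g x = g y"
proof -
  have "\<exists>e>0. \<forall>y. y \<in> S \<and> g y \<noteq> g x \<longrightarrow> e \<le> norm (g y - g x)" if "x \<in> S" for x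
    using that assms(3) gauss_int_norm_ge_1 gauss_int_closed(2)
    by (intro exI [of _ 1]) (metis eq_iff_diff_eq_0 zero_less_one)
  then have "g constant_on S"
    using continuous_discrete_range_constant assms(1,2) by blast
  then show ?thesis
    using assms(4,5) by (auto simp: constant_on_def)
qed

text \<open>Uniqueness of lifts up to deck transformations, in the form of equal increments of the two
lifts. It makes every invariant read off from a lift well defined.\<close>
lemma lifts_differ_by_constant:
  fixes g h :: "'a::topological_space \<Rightarrow> complex"
  assumes "connected S" "continuous_on S g" "continuous_on S h"
    and "\<And>x. x \<in> S \<Longrightarrow> torus_cover (g x) = torus_cover (h x)" "x \<in> S" "y \<in> S"
  shows "g x - h x = g y - h y"
  using assms(4) torus_cover_eq_iff
  by (intro gauss_int_valued_constant [OF assms(1) _ _ assms(5,6)] continuous_intros assms(2,3))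
     auto

lemma torus_cover_reduce:
  obtains w where "w \<in> cbox 0 (1 + \<i>)" "w - z \<in> gauss_int"
proof
  let ?w = "Complex (frac (Re z)) (frac (Im z))"
  show "?w \<in> cbox 0 (1 + \<i>)"
    by (simp add: in_cbox_complex_iff less_imp_le [OF frac_lt_1])
  show "?w - z \<in> gauss_int" by (simp add: gauss_int_def frac_def)
qed

lemma torus_cover_surj:
  assumes "p \<in> topspace torus"
  obtains z where "z \<in> cbox 0 (1 + \<i>)" "torus_cover z = p"
proof -
  obtain x y where xy: "p = (cis x, cis y)"
    using assms complex_norm_eq_1_exp
    by (metis (no_types, lifting) SigmaE cis_conv_exp mem_sphere_0 topspace_torus)
  obtain w where w: "w \<in> cbox 0 (1 + \<i>)" "w - Complex (x / (2 * pi)) (y / (2 * pi)) \<in> gauss_int"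
    by (rule torus_cover_reduce)
  have "torus_cover w = torus_cover (Complex (x / (2 * pi)) (y / (2 * pi)))"
    using w(2) torus_cover_eq_iff by blast
  also have "\<dots> = p" by (simp add: torus_cover_def xy)
  finally show ?thesis using that w(1) by blast
qed

text \<open>The unit square is compact and already covers the torus, which is Hausdorff. Restricting the
cover to it makes the quotient property a consequence of compactness.\<close>
lemma quotient_map_torus_cover:
  "quotient_map (top_of_set (cbox 0 (1 + \<i>))) torus torus_cover"
proof (rule continuous_closed_imp_quotient_map)
  let ?K = "top_of_set (cbox 0 (1 + \<i>))"
  show cont: "continuous_map ?K torus torus_cover"
    unfolding torus_eq continuous_map_subtopology_eu
    using torus_cover_in_torus continuous_on_torus_cover [of _ "\<lambda>x. x"]
    by (auto simp: topspace_torus)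
  have "Hausdorff_space torus"
    by (simp add: torus_eq Hausdorff_space_subtopology)
  then show "closed_map ?K torus torus_cover"
    using continuous_imp_closed_map_gen [OF _ Hausdorff_imp_kc_space cont]
    by (simp add: compact_space_subtopology)
  show "torus_cover ` topspace ?K = topspace torus"
  proof
    show "torus_cover ` topspace ?K \<subseteq> topspace torus" by auto
    show "topspace torus \<subseteq> torus_cover ` topspace ?K"
      by (metis image_eqI subsetI topspace_euclidean_subtopology torus_cover_surj)
  qed
qed

lemma periodic_map_descends:
  fixes g :: "complex \<Rightarrow> 'a::topological_space"
  assumes "continuous_on UNIV g" "\<And>z n. n \<in> gauss_int \<Longrightarrow> g (z + n) = g z"
  obtains h where "continuous_map torus euclidean h" "\<And>z. h (torus_cover z) = g z"
proof -
  have period: "g w = g z" if "w - z \<in> gauss_int" for w z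
    using assms(2) [OF that, of z] by simp
  have "continuous_map (top_of_set (cbox 0 (1 + \<i>))) euclidean g"
    using assms(1) continuous_on_subset by fastforce
  then obtain h where h: "continuous_map torus euclidean h"
      "\<And>w. w \<in> cbox 0 (1 + \<i>) \<Longrightarrow> h (torus_cover w) = g w"
    using quotient_map_lift_exists [OF quotient_map_torus_cover, of euclidean g] period
    by (metis topspace_euclidean_subtopology torus_cover_eq_iff)
  have "h (torus_cover z) = g z" for z
    by (metis h(2) period torus_cover_eq_iff torus_cover_reduce)
  with h(1) show ?thesis using that by blast
qed

section \<open>Lifts of self-maps of the torus\<close>

text \<open>The translate \<open>z \<mapsto> F (z + n)\<close> of a lift is again a lift of the same map, so it differs from
\<open>F\<close> by a constant. This constant depends additively on \<open>n\<close>, hence is given by an integral matrix.\<close>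
lemma torus_map_lift:
  assumes "continuous_map torus torus f"
  obtains F a b where "continuous_on UNIV F" "\<And>z. torus_cover (F z) = f (torus_cover z)"
    "a \<in> gauss_int" "b \<in> gauss_int" "\<And>z n. n \<in> gauss_int \<Longrightarrow> F (z + n) = F z + plane_linear a b n"
proof -
  have "continuous_on (topspace torus) f"
    using assms by (simp add: torus_eq continuous_map_in_subtopology)
  then have "continuous_on UNIV (\<lambda>z. f (torus_cover z))"
    by (rule continuous_on_compose2 [OF _ continuous_on_torus_cover [OF continuous_on_id]]) auto
  moreover have "(\<lambda>z. f (torus_cover z)) ` UNIV \<subseteq> topspace torus"
    using assms continuous_map_image_subset_topspace torus_cover_in_torus by blast
  ultimately obtain F where F: "continuous_on UNIV F" "\<And>z. torus_cover (F z) = f (torus_cover z)"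
    using torus_cover_lift [of UNIV "\<lambda>z. f (torus_cover z)"]
    by (metis UNIV_I contractible_UNIV)
  define d where "d n = F n - F 0" for n
  have shift: "F (z + n) = F z + d n" if n: "n \<in> gauss_int" for z n
  proof -
    have "torus_cover (F (w + n)) = torus_cover (F w)" for w
      by (metis F(2) add_diff_cancel_left' n torus_cover_eq_iff)
    moreover have "continuous_on UNIV (\<lambda>w. F (w + n))"
      by (intro continuous_on_compose2 [OF F(1)] continuous_intros) auto
    ultimately have "F (z + n) - F z = F (0 + n) - F 0"
      using lifts_differ_by_constant [OF connected_UNIV _ F(1)] by blast
    then show ?thesis by (simp add: d_def algebra_simps)
  qed
  have d_lattice: "d n \<in> gauss_int" if "n \<in> gauss_int" for n
  proof -
    have "torus_cover n = torus_cover 0" using that torus_cover_eq_iff by simp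
    then show ?thesis
      by (simp add: d_def F(2) flip: torus_cover_eq_iff)
  qed
  have d_add: "d (m + n) = d m + d n" if "n \<in> gauss_int" for m n
    using shift [OF that, of m] by (simp add: d_def)
  have d_mult: "d (of_int k * m) = of_int k * d m" if m: "m \<in> gauss_int" for k m
  proof (induction k rule: int_induct [of _ 0])
    case base
    show ?case by (simp add: d_def)
  next
    case (step1 k)
    then show ?case using d_add [OF m, of "of_int k * m"] by (simp add: algebra_simps)
  next
    case (step2 k)
    then show ?case using d_add [OF m, of "of_int (k - 1) * m"] by (simp add: algebra_simps)
  qed
  have "d n = plane_linear (d 1) (d \<i>) n" if n: "n \<in> gauss_int" for n
  proof -
    obtain j k where jk: "Re n = of_int j" "Im n = of_int k"
      using n by (auto simp: gauss_int_def elim!: Ints_cases)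
    have "of_int k * \<i> \<in> gauss_int" by (simp add: gauss_int_def)
    then have "d (of_int j * 1 + of_int k * \<i>) = of_int j * d 1 + of_int k * d \<i>"
      using d_add [of "of_int k * \<i>"] d_mult [of 1 j] d_mult [of \<i> k] by simp
    moreover have "n = of_int j * 1 + of_int k * \<i>"
      by (simp add: complex_eq_iff jk)
    ultimately show ?thesis
      by (simp add: plane_linear_def jk scaleR_conv_of_real)
  qed
  with that F d_lattice shift show ?thesis by (metis gauss_int_simps(2,3))
qed

section \<open>Involutions of the plane\<close>

text \<open>If \<open>S\<close> had no fixed point, then \<open>S z - z\<close> would have a continuous logarithm \<open>l\<close>. Applying \<open>S\<close>
changes the sign of \<open>S z - z\<close>, so \<open>l (S z) - l z\<close> is an odd multiple of \<open>\<pi> \<i>\<close>, and the same one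
for all \<open>z\<close> by continuity. Going from \<open>z\<close> to \<open>S z\<close> and back gives the opposite value, so the
multiple would be zero, which is not odd.\<close>
lemma plane_involution_fixed_point:
  fixes S :: "complex \<Rightarrow> complex"
  assumes cont: "continuous_on UNIV S" and inv: "\<And>z. S (S z) = z"
  obtains z where "S z = z"
proof (rule ccontr)
  assume "\<not> thesis"
  then have "S z - z \<noteq> 0" for z using that by auto
  moreover have "continuous_on UNIV (\<lambda>z. S z - z)" by (intro continuous_intros cont)
  ultimately obtain l where l: "continuous_on UNIV l" "\<And>z. S z - z = exp (l z)"
    using continuous_logarithm_on_contractible [of UNIV "\<lambda>z. S z - z"]
    by (metis UNIV_I contractible_UNIV)
  \<comment> \<open>normalized so that an odd multiple of \<open>\<pi> \<i>\<close> becomes an integer\<close>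
  define d where "d z = (l (S z) - l z) / (2 * pi * \<i>) - 1 / 2" for z
  have "d z \<in> gauss_int" for z
  proof -
    have "exp (l (S z)) = exp (l z + \<i> * pi)"
      using l(2) [of z] l(2) [of "S z"]
      by (simp add: inv exp_add) (metis minus_diff_eq)
    then obtain n :: int where "l (S z) = l z + \<i> * pi + (of_int (2 * n) * pi) * \<i>"
      using exp_eq by blast
    then have "d z = of_int n"
      by (simp add: d_def field_simps)
    then show ?thesis by (simp add: gauss_int_def)
  qed
  moreover have "continuous_on UNIV d"
    unfolding d_def by (intro continuous_intros continuous_on_compose2 [OF l(1)] cont l) auto
  ultimately have const: "d (S 0) = d 0"
    using gauss_int_valued_constant [of UNIV d] by auto
  have "d (S 0) + d 0 = - 1"
    by (simp add: d_def inv field_simps)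
  then have "2 * d 0 = - 1" using const by simp
  then have "d 0 = - (1 / 2)" by (simp add: field_simps)
  moreover have "Re (d 0) \<in> \<int>" using \<open>\<And>z. d z \<in> gauss_int\<close> by (simp add: gauss_int_def)
  ultimately show False
    by (auto elim!: Ints_cases)
qed

section \<open>The degree of a self-map of the torus\<close>

text \<open>Barycentric coordinates with respect to \<open>0\<close>, \<open>1\<close>, \<open>\<i>\<close>. They map the triangle with these vertices
onto the standard 2-simplex and the real unit interval onto the standard 1-simplex. The
planar triangle serves as the domain of lifts, since \<open>torus_cover_lift\<close> is about normed spaces.\<close>
definition triangle_point :: "complex \<Rightarrow> nat \<Rightarrow> real"
  where "triangle_point z = (\<lambda>i. if i = 0 then 1 - Re z - Im z else if i = 1 then Re z
                              else if i = 2 then Im z else 0)"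

text \<open>The difference of the endpoints of a lift of the path \<open>\<gamma>\<close>. Its real and imaginary parts are two
1-cocycles on the torus; on loops they count the turns around the two circle factors.\<close>
definition displacement :: "((nat \<Rightarrow> real) \<Rightarrow> complex \<times> complex) \<Rightarrow> complex"
  where "displacement \<gamma> = (THE d. \<exists>h. continuous_on {0..1} h \<and> d = h 1 - h 0 \<and>
           (\<forall>t\<in>{0..1::real}. torus_cover (h t) = \<gamma> (triangle_point (of_real t))))"

text \<open>The cup product of these two 1-cocycles: the first is evaluated on the front edge, opposite to
vertex 2, and the second on the back edge, opposite to vertex 0.\<close>
definition cup_cocycle :: "((nat \<Rightarrow> real) \<Rightarrow> complex \<times> complex) \<Rightarrow> real"
  where "cup_cocycle \<sigma> =
           Re (displacement (singular_face 2 2 \<sigma>)) * Im (displacement (singular_face 2 0 \<sigma>))"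

definition evaluate :: "('a \<Rightarrow> real) \<Rightarrow> ('a \<Rightarrow>\<^sub>0 int) \<Rightarrow> real"
  where "evaluate \<phi> c = (\<Sum>x\<in>Poly_Mapping.keys c. of_int (Poly_Mapping.lookup c x) * \<phi> x)"

lemma displacement_eq:
  fixes h :: "real \<Rightarrow> complex"
  assumes "continuous_on {0..1} h"
    and "\<And>t. t \<in> {0..1} \<Longrightarrow> torus_cover (h t) = \<gamma> (triangle_point (of_real t))"
  shows "displacement \<gamma> = h 1 - h 0"
  unfolding displacement_def
proof (rule the_equality)
  show "\<exists>g. continuous_on {0..1} g \<and> h 1 - h 0 = g 1 - g 0 \<and>
          (\<forall>t\<in>{0..1}. torus_cover (g t) = \<gamma> (triangle_point (of_real t)))"
    using assms by blast
next
  fix d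
  assume "\<exists>g. continuous_on {0..1} g \<and> d = g 1 - g 0 \<and>
            (\<forall>t\<in>{0..1::real}. torus_cover (g t) = \<gamma> (triangle_point (of_real t)))"
  then obtain g where g: "continuous_on {0..1::real} g" "d = g 1 - g 0"
      "\<And>t. t \<in> {0..1} \<Longrightarrow> torus_cover (g t) = \<gamma> (triangle_point (of_real t))"
    by blast
  then have "g 1 - h 1 = g 0 - h 0"
    using assms(2) by (intro lifts_differ_by_constant [OF _ g(1) assms(1)]) auto
  then show "d = h 1 - h 0" by (simp add: g(2) algebra_simps)
qed

lemma continuous_on_triangle_point [continuous_intros]:
  assumes "continuous_on S g"
  shows "continuous_on S (\<lambda>x. triangle_point (g x))"
proof (rule continuous_on_coordinatewise_then_product)
  fix i :: nat
  consider "i = 0" | "i = 1" | "i = 2" | "i > (2::nat)" by linarith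
  then show "continuous_on S (\<lambda>x. triangle_point (g x) i)"
    by cases (auto simp: triangle_point_def intro!: continuous_intros assms)
qed

lemma triangle_point_edge:
  "t \<in> {0..1} \<Longrightarrow> triangle_point (of_real t) \<in> standard_simplex 1"
  by (auto simp: standard_simplex_def triangle_point_def)

lemma face_of_edge:
  "simplical_face 0 (triangle_point (of_real t)) = triangle_point (of_real (1 - t) + of_real t * \<i>)"
  "simplical_face 1 (triangle_point (of_real t)) = triangle_point (of_real t * \<i>)"
  "simplical_face 2 (triangle_point (of_real t)) = triangle_point (of_real t)"
  by (auto simp: simplical_face_def triangle_point_def fun_eq_iff)

text \<open>The cocycle property: a lift of the whole triangle restricts to lifts of the three edges.\<close>
lemma displacement_additive:
  assumes "singular_simplex 2 torus \<sigma>"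
  shows "displacement (singular_face 2 2 \<sigma>) + displacement (singular_face 2 0 \<sigma>)
           = displacement (singular_face 2 1 \<sigma>)"
proof -
  let ?K = "{z. 0 \<le> Re z \<and> 0 \<le> Im z \<and> Re z + Im z \<le> 1}"
  have K: "triangle_point ` ?K \<subseteq> standard_simplex 2"
    by (auto simp: standard_simplex_def triangle_point_def numeral_2_eq_2)
  have cont: "continuous_map (top_of_set (standard_simplex 2)) torus \<sigma>"
    using assms by (simp add: singular_simplex_def euclidean_product_topology)
  then have \<sigma>: "\<sigma> ` standard_simplex 2 \<subseteq> topspace torus"
    using continuous_map_image_subset_topspace by fastforce
  have "continuous_on (standard_simplex 2) \<sigma>"
    using cont by (simp add: torus_eq continuous_map_in_subtopology)
  then have "continuous_on ?K (\<lambda>z. \<sigma> (triangle_point z))"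
    using K by (auto intro!: continuous_on_compose2 [of "standard_simplex 2" \<sigma>] continuous_intros)
  moreover have "(\<lambda>z. \<sigma> (triangle_point z)) ` ?K \<subseteq> topspace torus"
    using K \<sigma> by blast
  moreover have "contractible ?K"
  proof (intro convex_imp_contractible convexI)
    fix x y :: complex and u v :: real
    assume *: "x \<in> ?K" "y \<in> ?K" "0 \<le> u" "0 \<le> v" "u + v = 1"
    then have "u * (Re x + Im x) + v * (Re y + Im y) \<le> 1"
      by (intro convex_bound_le) auto
    with * show "u *\<^sub>R x + v *\<^sub>R y \<in> ?K" by (simp add: algebra_simps)
  qed
  ultimately obtain L where L: "continuous_on ?K L"
      "\<And>z. z \<in> ?K \<Longrightarrow> torus_cover (L z) = \<sigma> (triangle_point z)"
    using torus_cover_lift [of ?K "\<lambda>z. \<sigma> (triangle_point z)"] by blast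
  have edge: "displacement (singular_face 2 k \<sigma>) = L (e 1) - L (e 0)"
    if e: "continuous_on {0..1} e" "e ` {0..1} \<subseteq> ?K"
      "\<And>t. simplical_face k (triangle_point (of_real t)) = triangle_point (e t)"
    for k and e :: "real \<Rightarrow> complex"
  proof (rule displacement_eq)
    show "continuous_on {0..1} (\<lambda>t. L (e t))"
      using e(2) by (intro continuous_on_compose2 [OF L(1) e(1)]) auto
    show "torus_cover (L (e t)) = singular_face 2 k \<sigma> (triangle_point (of_real t))"
      if "t \<in> {0..1}" for t
    proof -
      have "e t \<in> ?K" using that e(2) by blast
      with triangle_point_edge [OF that] show ?thesis
        by (simp add: L(2) singular_face_def e(3))
    qed
  qed
  have "displacement (singular_face 2 2 \<sigma>) = L (of_real 1) - L (of_real 0)"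
    by (rule edge) (auto simp: face_of_edge intro!: continuous_intros)
  moreover have "displacement (singular_face 2 1 \<sigma>) = L (of_real 1 * \<i>) - L (of_real 0 * \<i>)"
    by (rule edge [of "\<lambda>t. of_real t * \<i>"]) (auto simp only: face_of_edge, auto intro!: continuous_intros)
  moreover have "displacement (singular_face 2 0 \<sigma>)
      = L (of_real (1 - 1) + of_real 1 * \<i>) - L (of_real (1 - 0) + of_real 0 * \<i>)"
    by (rule edge [of "\<lambda>t. of_real (1 - t) + of_real t * \<i>"])
       (auto simp only: face_of_edge, auto intro!: continuous_intros)
  ultimately show ?thesis by simp
qed

lemma singular_face_singular_face:
  assumes "i < j" "j \<le> Suc p" "1 \<le> p"
  shows "singular_face p i (singular_face (Suc p) j f) = singular_face p (j - 1) (singular_face (Suc p) i f)"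
proof
  fix x
  have "simplical_face j (simplical_face i x) = simplical_face i (simplical_face (j - 1) x)" for x :: "nat \<Rightarrow> real"
    using assms(1) by (auto simp: simplical_face_def fun_eq_iff)
  moreover have "simplical_face k x \<in> standard_simplex p" if "x \<in> standard_simplex (p - 1)" "k \<le> p" for k
    using simplical_face_in_standard_simplex [of p k x] that assms(3) by simp
  ultimately show "singular_face p i (singular_face (Suc p) j f) x
      = singular_face p (j - 1) (singular_face (Suc p) i f) x"
    using assms by (simp add: singular_face_def restrict_def)
qed

text \<open>The usual proof that a cup product of cocycles is a cocycle: the four faces of a tetrahedron
share their edges pairwise, and the terms cancel by additivity of the displacement on the faces
opposite to the vertices 0 and 3.\<close>
lemma cup_cocycle_closed:
  assumes "singular_simplex 3 torus \<rho>"
  shows "(\<Sum>k\<le>3. (- 1) ^ k * cup_cocycle (singular_face 3 k \<rho>)) = 0"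
proof -
  define e where "e i j = displacement (singular_face 2 i (singular_face 3 j \<rho>))" for i j
  have "singular_simplex 2 torus (singular_face 3 k \<rho>)" if "k \<le> 3" for k
    using singular_simplex_singular_face [OF assms _ that] by simp
  then have add: "e 2 k + e 0 k = e 1 k" if "k \<le> 3" for k
    using that displacement_additive unfolding e_def by blast
  have swap: "e i j = e (j - 1) i" if "i < j" "j \<le> 3" for i j
    using singular_face_singular_face [of i j 2 \<rho>] that by (simp add: e_def eval_nat_numeral)
  have "e 0 1 = e 0 0" "e 0 2 = e 1 0" "e 0 3 = e 2 0" "e 1 3 = e 2 1" "e 2 3 = e 2 2"
    using swap [of 0 1] swap [of 0 2] swap [of 0 3] swap [of 1 3] swap [of 2 3] by simp_all
  moreover have "e 1 0 = e 2 0 + e 0 0" "e 2 1 = e 2 2 + e 2 0"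
    using add [of 0] add [of 3] calculation by simp_all
  ultimately show ?thesis
    by (simp add: eval_nat_numeral cup_cocycle_def flip: e_def)
       (simp add: algebra_simps flip: e_def numeral_2_eq_2 numeral_3_eq_3)
qed

lemma evaluate_frag_of [simp]: "evaluate \<phi> (frag_of x) = \<phi> x"
  by (simp add: evaluate_def)

lemma evaluate_zero [simp]: "evaluate \<phi> 0 = 0"
  by (simp add: evaluate_def)

lemma evaluate_superset:
  assumes "finite A" "Poly_Mapping.keys c \<subseteq> A"
  shows "evaluate \<phi> c = (\<Sum>x\<in>A. of_int (Poly_Mapping.lookup c x) * \<phi> x)"
  unfolding evaluate_def
  by (rule sum.mono_neutral_left [OF assms]) (simp add: in_keys_iff)

lemma evaluate_diff: "evaluate \<phi> (c - d) = evaluate \<phi> c - evaluate \<phi> d"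
proof -
  let ?A = "Poly_Mapping.keys c \<union> Poly_Mapping.keys d"
  have "finite ?A" "Poly_Mapping.keys (c - d) \<subseteq> ?A" by (auto simp: keys_diff)
  then show ?thesis
    by (simp add: evaluate_superset [of ?A] lookup_minus algebra_simps sum_subtractf)
qed

lemma evaluate_cmul: "evaluate \<phi> (frag_cmul k c) = of_int k * evaluate \<phi> c"
proof -
  have "Poly_Mapping.keys (frag_cmul k c) \<subseteq> Poly_Mapping.keys c" by (rule keys_cmul)
  then show ?thesis
    by (simp add: evaluate_superset [of "Poly_Mapping.keys c"] sum_distrib_left mult.assoc)
qed

lemma evaluate_add: "evaluate \<phi> (c + d) = evaluate \<phi> c + evaluate \<phi> d"
  using evaluate_diff [of \<phi> "c + d" d] by simp

lemma evaluate_sum: "evaluate \<phi> (\<Sum>i\<in>I. c i) = (\<Sum>i\<in>I. evaluate \<phi> (c i))"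
  by (induction I rule: infinite_finite_induct) (simp_all add: evaluate_add)

lemma evaluate_boundary:
  assumes "singular_chain 3 torus d"
  shows "evaluate cup_cocycle (chain_boundary 3 d) = 0"
  using assms unfolding singular_chain_def
proof (induction d rule: frag_induction)
  case zero
  show ?case by simp
next
  case (one \<rho>)
  then show ?case
    using cup_cocycle_closed [of \<rho>]
    by (simp add: chain_boundary_of evaluate_sum evaluate_cmul)
next
  case (diff a b)
  then show ?case by (simp add: chain_boundary_diff evaluate_diff)
qed

text \<open>The image of the straight triangle with vertices \<open>0\<close>, \<open>a\<close>, \<open>b\<close>.\<close>
definition torus_triangle :: "complex \<Rightarrow> complex \<Rightarrow> (nat \<Rightarrow> real) \<Rightarrow> complex \<times> complex"
  where "torus_triangle a b = restrict (\<lambda>x. torus_cover (x 1 *\<^sub>R a + x 2 *\<^sub>R b)) (standard_simplex 2)"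

definition torus_loop :: "complex \<Rightarrow> (nat \<Rightarrow> real) \<Rightarrow> complex \<times> complex"
  where "torus_loop a = restrict (\<lambda>x. torus_cover (x 1 *\<^sub>R a)) (standard_simplex 1)"

text \<open>The unit square cut along its diagonal, which represents a fundamental class.\<close>
definition torus_cycle :: "(complex \<times> complex) chain"
  where "torus_cycle = frag_of (torus_triangle 1 (1 + \<i>)) - frag_of (torus_triangle \<i> (1 + \<i>))"

lemma singular_simplex_torus_triangle: "singular_simplex 2 torus (torus_triangle a b)"
proof -
  have "continuous_on (standard_simplex 2) (\<lambda>x. torus_cover (x 1 *\<^sub>R a + x 2 *\<^sub>R b))"
    by (intro continuous_intros continuous_on_product_coordinates continuous_on_subset [OF _ subset_UNIV])
  moreover have "torus_cover z \<in> sphere 0 1 \<times> sphere 0 1" for z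
    using torus_cover_in_torus topspace_torus by blast
  ultimately show ?thesis
    by (auto simp: singular_simplex_def torus_triangle_def torus_eq continuous_map_in_subtopology
        euclidean_product_topology simp del: continuous_map_subtopology_eu)
qed

text \<open>The face opposite to vertex 0 is the segment from \<open>a\<close> to \<open>b\<close>; since \<open>a\<close> is a deck translation, it
has the same image as the segment from \<open>0\<close> to \<open>b - a\<close>. This is what identifies opposite sides of
the square.\<close>
lemma faces_torus_triangle:
  assumes "a \<in> gauss_int"
  shows "singular_face 2 0 (torus_triangle a b) = torus_loop (b - a)"
    and "singular_face 2 1 (torus_triangle a b) = torus_loop b"
    and "singular_face 2 2 (torus_triangle a b) = torus_loop a"
proof -
  have "torus_cover (x 0 *\<^sub>R a + x 1 *\<^sub>R b) = torus_cover (x 1 *\<^sub>R (b - a))"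
    if "x \<in> standard_simplex 1" for x :: "nat \<Rightarrow> real"
  proof -
    have "x 0 *\<^sub>R a + x 1 *\<^sub>R b - x 1 *\<^sub>R (b - a) = (x 0 + x 1) *\<^sub>R a"
      by (simp add: algebra_simps)
    also have "x 0 + x 1 = 1" using that by (simp add: standard_simplex_def)
    finally have "x 0 *\<^sub>R a + x 1 *\<^sub>R b - x 1 *\<^sub>R (b - a) = a" by simp
    then show ?thesis using assms by (simp only: torus_cover_eq_iff)
  qed
  then show "singular_face 2 0 (torus_triangle a b) = torus_loop (b - a)"
    unfolding torus_triangle_def torus_loop_def
    by (subst singular_face_restrict; auto simp: singular_face_def simplical_face_def fun_eq_iff)
  show "singular_face 2 1 (torus_triangle a b) = torus_loop b"
    "singular_face 2 2 (torus_triangle a b) = torus_loop a"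
    unfolding torus_triangle_def torus_loop_def
    by (subst singular_face_restrict; auto simp: singular_face_def simplical_face_def fun_eq_iff)+
qed

lemma singular_relcycle_torus_cycle: "singular_relcycle 2 torus {} torus_cycle"
  unfolding singular_cycle
proof
  show "singular_chain 2 torus torus_cycle"
    unfolding torus_cycle_def
    by (intro singular_chain_diff) (simp_all add: singular_chain_of singular_simplex_torus_triangle)
  have "chain_boundary 2 (frag_of (torus_triangle a b))
      = frag_of (torus_loop (b - a)) - frag_of (torus_loop b) + frag_of (torus_loop a)"
    if "a \<in> gauss_int" for a b
    using faces_torus_triangle [OF that, of b]
    by (simp add: chain_boundary_of numeral_2_eq_2)
  then show "chain_boundary 2 torus_cycle = 0"
    by (simp add: torus_cycle_def chain_boundary_diff)
qed

lemma displacement_torus_loop_image: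
  assumes "continuous_on UNIV F" "\<And>z. torus_cover (F z) = f (torus_cover z)"
  shows "displacement (simplex_map 1 f (torus_loop a)) = F a - F 0"
proof -
  have "displacement (simplex_map 1 f (torus_loop a)) = F (1 *\<^sub>R a) - F (0 *\<^sub>R a)"
  proof (rule displacement_eq)
    show "continuous_on {0..1} (\<lambda>t. F (t *\<^sub>R a))"
      by (intro continuous_on_compose2 [OF assms(1)] continuous_intros) auto
    show "torus_cover (F (t *\<^sub>R a)) = simplex_map 1 f (torus_loop a) (triangle_point (of_real t))"
      if "t \<in> {0..1}" for t
      using triangle_point_edge [OF that]
      by (simp add: assms(2) simplex_map_def torus_loop_def triangle_point_def)
  qed
  then show ?thesis by simp
qed

text \<open>The degree of \<open>f\<close>, obtained on the chain level: the edges of the square are displaced by \<open>a\<close> and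
\<open>b\<close>, and the two triangles contribute the two products in the determinant.\<close>
lemma evaluate_torus_cycle_image:
  assumes "continuous_on UNIV F" "\<And>z. torus_cover (F z) = f (torus_cover z)"
    and "\<And>z n. n \<in> gauss_int \<Longrightarrow> F (z + n) = F z + plane_linear a b n"
  shows "evaluate cup_cocycle (chain_map 2 f torus_cycle) = Re a * Im b - Re b * Im a"
proof -
  have face: "singular_face 2 k (simplex_map 2 f \<sigma>) = simplex_map 1 f (singular_face 2 k \<sigma>)"
    if "k \<le> 2" for k \<sigma>
    using that by (simp add: singular_face_simplex_map) (simp add: simplex_map_def singular_face_def fun_eq_iff)
  have F: "F 1 - F 0 = a" "F \<i> - F 0 = b"
    using assms(3) [of 1 0] assms(3) [of \<i> 0] by (simp_all add: plane_linear_def)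
  show ?thesis
    by (simp add: torus_cycle_def chain_map_diff evaluate_diff cup_cocycle_def face
        faces_torus_triangle F displacement_torus_loop_image [OF assms(1,2), unfolded One_nat_def])
qed

text \<open>If \<open>f\<close> fixes the class of \<open>torus_cycle\<close>, the cocycle takes the same value on this cycle and
on its image, and these values are \<open>1\<close> and the determinant.\<close>
lemma orientation_preserving_det:
  assumes "continuous_map torus torus f" "preserves_orientation 2 torus f"
    and lift: "continuous_on UNIV F" "\<And>z. torus_cover (F z) = f (torus_cover z)"
      "\<And>z n. n \<in> gauss_int \<Longrightarrow> F (z + n) = F z + plane_linear a b n"
  shows "Re a * Im b - Re b * Im a = 1"
proof -
  let ?cls = "homologous_rel_set 2 torus {}"
  have "?cls torus_cycle \<in> carrier (homology_group (int 2) torus)"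
    unfolding carrier_relative_homology_group using singular_relcycle_torus_cycle by blast
  then have "hom_induced (int 2) torus {} torus {} f (?cls torus_cycle) = ?cls torus_cycle"
    using assms(2) [unfolded preserves_orientation_def] by (rule bspec [rotated])
  then have "?cls (chain_map 2 f torus_cycle) = ?cls torus_cycle"
    using hom_induced_chain_map [OF assms(1) _ singular_relcycle_torus_cycle] by simp
  then have "homologous_rel 2 torus {} (chain_map 2 f torus_cycle) torus_cycle"
    by (simp only: homologous_rel_set_eq)
  then have "singular_relboundary 2 torus {} (chain_map 2 f torus_cycle - torus_cycle)"
    unfolding homologous_rel_def .
  then obtain d where "singular_chain 3 torus d"
      "chain_boundary 3 d = chain_map 2 f torus_cycle - torus_cycle"
    unfolding singular_boundary by (auto simp: numeral_3_eq_3 numeral_2_eq_2)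
  then have "evaluate cup_cocycle (chain_map 2 f torus_cycle) - evaluate cup_cocycle torus_cycle = 0"
    by (metis evaluate_boundary evaluate_diff)
  moreover have "evaluate cup_cocycle (chain_map 2 id torus_cycle) = Re 1 * Im \<i> - Re \<i> * Im 1"
    by (rule evaluate_torus_cycle_image [of id])
       (auto simp: plane_linear_def complex_eq_iff)
  moreover have "chain_map 2 id torus_cycle = torus_cycle"
    by (metis chain_map_ident singular_cycle singular_relcycle_torus_cycle)
  ultimately show ?thesis
    by (simp add: evaluate_torus_cycle_image [OF lift])
qed

section \<open>Lifting the involution\<close>

text \<open>The first three hypotheses are entries of the matrix equation \<open>B\<^sup>2 = 1\<close> and the last is
\<open>det B = 1\<close>. By the Cayley-Hamilton theorem \<open>(tr B) B = B\<^sup>2 + det B = 2\<close>, so \<open>B\<close> is a scalar matrix.\<close>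
lemma integer_involution_det_1:
  fixes a b c d :: real
  assumes "a * a + b * c = 1" "b * (a + d) = 0" "c * (a + d) = 0" "a * d - b * c = 1"
  shows "b = 0 \<and> c = 0 \<and> d = a \<and> (a = 1 \<or> a = - 1)"
proof -
  have "a * (a + d) = 2" using assms(1,4) by (simp add: algebra_simps)
  then have "a + d \<noteq> 0" by auto
  then have bc: "b = 0" "c = 0" using assms(2,3) by auto
  then have "a * a = 1" "a * d = a * a" using assms(1,4) by auto
  then show ?thesis using bc by (auto simp: square_eq_1_iff)
qed

text \<open>For a lift \<open>T\<close> with matrix \<open>B\<close>, the map \<open>T \<circ> T\<close> lifts the identity and is therefore a translation
by some \<open>v\<close>. This forces \<open>B\<^sup>2 = 1\<close>, and \<open>det B = 1\<close> by orientation, so \<open>B = \<plusminus> 1\<close>. A fixed point of any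
lift would be a fixed point of the free map \<open>\<tau>\<close>, whereas every involution of the plane has one.
This excludes \<open>B = - 1\<close>, where \<open>T\<close> itself turns out to be an involution, and, for \<open>B = 1\<close>, an even
\<open>v\<close>, for which \<open>T - v / 2\<close> would be an involution.\<close>
lemma involution_lift:
  assumes "free_involution torus \<tau>" "preserves_orientation 2 torus \<tau>"
  obtains T v where "continuous_on UNIV T" "\<And>z. torus_cover (T z) = \<tau> (torus_cover z)"
    "\<And>z n. n \<in> gauss_int \<Longrightarrow> T (z + n) = T z + n" "\<And>z. T (T z) = z + v"
    "v \<in> gauss_int" "v / 2 \<notin> gauss_int"
proof -
  have cont: "continuous_map torus torus \<tau>"
    and invol: "\<And>p. p \<in> topspace torus \<Longrightarrow> \<tau> (\<tau> p) = p"
    and free: "\<And>p. p \<in> topspace torus \<Longrightarrow> \<tau> p \<noteq> p"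
    using assms(1) by (auto simp: free_involution_def)
  obtain T a b where T: "continuous_on UNIV T" "\<And>z. torus_cover (T z) = \<tau> (torus_cover z)"
      and ab: "a \<in> gauss_int" "b \<in> gauss_int"
      and shift: "\<And>z n. n \<in> gauss_int \<Longrightarrow> T (z + n) = T z + plane_linear a b n"
    using torus_map_lift [OF cont] by blast
  have contTT: "continuous_on UNIV (\<lambda>z. T (T z))"
    by (rule continuous_on_compose2 [OF T(1) T(1)]) auto
  have no_fix: "T z - z \<notin> gauss_int" for z
    using free [of "torus_cover z"] T(2) torus_cover_eq_iff by (metis torus_cover_in_torus)
  have cover_TT: "torus_cover (T (T z)) = torus_cover z" for z
    by (simp add: T(2) invol)
  define v where "v = T (T 0)"
  have v: "v \<in> gauss_int"
    using cover_TT [of 0] by (simp add: v_def torus_cover_eq_iff)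
  have TT: "T (T z) = z + v" for z
    using lifts_differ_by_constant [OF connected_UNIV contTT continuous_on_id, of z 0] cover_TT
    by (simp add: v_def algebra_simps)
  have square: "plane_linear a b (plane_linear a b n) = n" if "n \<in> gauss_int" for n
    using TT [of n] shift [OF that, of 0] shift [OF plane_linear_gauss_int [OF ab that], of "T 0"]
    by (simp add: v_def)
  have det: "Re a * Im b - Re b * Im a = 1"
    using orientation_preserving_det [OF cont assms(2) T shift] .
  have "Im a = 0 \<and> Re b = 0 \<and> Im b = Re a \<and> (Re a = 1 \<or> Re a = - 1)"
  proof (rule integer_involution_det_1)
    show "Re a * Re a + Im a * Re b = 1" "Im a * (Re a + Im b) = 0"
      using square [of 1] by (simp_all add: plane_linear_def complex_eq_iff algebra_simps)
    show "Re b * (Re a + Im b) = 0"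
      using square [of \<i>] by (simp add: plane_linear_def complex_eq_iff algebra_simps)
    show "Re a * Im b - Im a * Re b = 1" using det by (simp add: algebra_simps)
  qed
  then consider "a = 1" "b = \<i>" | "a = - 1" "b = - \<i>"
    by (auto simp: complex_eq_iff)
  then show ?thesis
  proof cases
    case 1
    have shift1: "T (z + n) = T z + n" if "n \<in> gauss_int" for z n
      using shift [OF that, of z] 1 by (simp add: plane_linear_def complex_eq_iff)
    have "v / 2 \<notin> gauss_int"
    proof
      assume half: "v / 2 \<in> gauss_int"
      have "T (T z - v / 2) - v / 2 = z" for z
        using shift1 [OF gauss_int_uminus [OF half], of "T z"] TT [of z] by simp
      moreover have "continuous_on UNIV (\<lambda>z. T z - v / 2)" by (intro continuous_intros T(1))
      ultimately obtain z where "T z - v / 2 = z"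
        using plane_involution_fixed_point [of "\<lambda>z. T z - v / 2"] by blast
      then have "T z - z = v / 2" by (simp add: algebra_simps)
      then show False using half no_fix by metis
    qed
    then show ?thesis using that T shift1 TT v by blast
  next
    case 2
    have "T (z + n) = T z - n" if "n \<in> gauss_int" for z n
      using shift [OF that, of z] 2 by (simp add: plane_linear_def complex_eq_iff)
    \<comment> \<open>computing \<open>T (T (T 0))\<close> in two ways gives \<open>v = - v\<close>\<close>
    then have "T (T (T 0)) = T 0 - v"
      using v by (metis TT)
    then have "v = 0" using TT [of "T 0"] by (simp add: complex_eq_iff)
    then obtain z where "T z = z"
      using plane_involution_fixed_point [OF T(1)] TT by auto
    then show ?thesis using no_fix [of z] by simp
  qed
qed

section \<open>Deforming a map\<close>

lemma cis_antiperiodic: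
  assumes "k \<in> \<int>" "k / 2 \<notin> \<int>"
  shows "cis (2 * pi * (t + k / 2)) = - cis (2 * pi * t)"
proof -
  obtain i :: int where i: "k = of_int i" using assms(1) by (auto elim: Ints_cases)
  have "odd i"
    using assms(2) by (auto simp: i elim!: evenE)
  then obtain j where "i = 2 * j + 1" by (auto elim: oddE)
  then have "k / 2 - 1 / 2 = of_int j" by (simp add: i field_simps)
  then have "cis (2 * pi * (k / 2)) = cis (2 * pi * (1 / 2))"
    using cis_eq_iff_Ints Ints_of_int by metis
  then have "cis (2 * pi * (k / 2)) = - 1" by simp
  then show ?thesis
    by (simp add: distrib_left flip: cis_mult)
qed

text \<open>Otherwise \<open>u / 2\<close> would be a Gaussian integer of norm \<open>1 / 2\<close>.\<close>
lemma half_gauss_int_minus_small: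
  assumes "m \<in> gauss_int" "norm u = 1"
  shows "m / 2 - u / 4 \<notin> gauss_int"
proof
  assume n: "m / 2 - u / 4 \<in> gauss_int"
  define w where "w = m - (m / 2 - u / 4) - (m / 2 - u / 4)"
  have "w \<in> gauss_int"
    unfolding w_def by (intro gauss_int_closed assms(1) n)
  moreover have "norm w = 1 / 2" using assms(2) by (simp add: w_def norm_divide)
  ultimately show False
    using gauss_int_norm_ge_1 [of w] by fastforce
qed

text \<open>Multiplication of a map by the null-homotopic map \<open>torus_cover \<circ> D\<close> in the group structure of the
torus; scaling \<open>D\<close> from \<open>0\<close> to \<open>1\<close> is the homotopy.\<close>
lemma torus_map_homotopic_translate:
  assumes f: "continuous_map torus torus f" and D: "continuous_map torus euclidean D"
  shows "homotopic_with (\<lambda>_. True) torus torus f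
           (\<lambda>p. (fst (f p) * cis (2 * pi * Re (D p)), snd (f p) * cis (2 * pi * Im (D p))))"
proof -
  define h where "h x = (fst (f (snd x)) * cis (2 * pi * (fst x * Re (D (snd x)))),
                         snd (f (snd x)) * cis (2 * pi * (fst x * Im (D (snd x)))))" for x :: "real \<times> complex \<times> complex"
  have "continuous_on (sphere 0 1 \<times> sphere 0 1) f" "continuous_on (sphere 0 1 \<times> sphere 0 1) D"
    using f D by (auto simp: torus_eq continuous_map_in_subtopology)
  then have "continuous_on ({0..1} \<times> (sphere 0 1 \<times> sphere 0 1)) (\<lambda>x. f (snd x))"
       "continuous_on ({0..1} \<times> (sphere 0 1 \<times> sphere 0 1)) (\<lambda>x. D (snd x))"
    by (auto intro!: continuous_on_compose2 [OF _ continuous_on_snd [OF continuous_on_id]])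
  then have "continuous_on ({0..1} \<times> (sphere 0 1 \<times> sphere 0 1)) h"
    unfolding h_def by (intro continuous_intros)
  moreover have "h (t, p) \<in> sphere 0 1 \<times> sphere 0 1" if "p \<in> sphere 0 1 \<times> sphere 0 1" for t p
  proof -
    have "f p \<in> sphere 0 1 \<times> sphere 0 1"
      using f that continuous_map_image_subset_topspace by (metis image_subset_iff topspace_torus)
    then show ?thesis by (auto simp: h_def norm_mult mem_Times_iff)
  qed
  ultimately have "continuous_map (prod_topology (top_of_set {0..1}) torus) torus h"
    unfolding torus_eq prod_topology_subtopology_eu continuous_map_subtopology_eu by auto
  then show ?thesis
    unfolding homotopic_with_def by (intro exI [of _ h]) (auto simp: h_def)
qed

theorem theorem1:
  fixes \<tau> :: "complex \<times> complex \<Rightarrow> complex \<times> complex"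
    and \<beta> :: "(complex \<times> complex \<Rightarrow> complex \<times> complex) set"
  assumes "free_involution torus \<tau>"
    and "preserves_orientation 2 torus \<tau>"
    and "\<beta> \<in> homotopy_classes torus torus"
  shows "\<not> Borsuk_Ulam_property torus torus \<tau> \<beta>"
proof -
  obtain T v where T: "continuous_on UNIV T" "\<And>z. torus_cover (T z) = \<tau> (torus_cover z)"
      and T_shift: "\<And>z n. n \<in> gauss_int \<Longrightarrow> T (z + n) = T z + n"
      and TT: "\<And>z. T (T z) = z + v"
      and v: "v \<in> gauss_int" "v / 2 \<notin> gauss_int"
    using involution_lift [OF assms(1,2)] by blast
  obtain f where f: "continuous_map torus torus f" and \<beta>: "\<beta> = homotopy_rel torus torus `` {f}"
    using assms(3) by (auto simp: homotopy_classes_def elim: quotientE)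
  obtain F a b where F: "continuous_on UNIV F" "\<And>z. torus_cover (F z) = f (torus_cover z)"
      and ab: "a \<in> gauss_int" "b \<in> gauss_int"
      and F_shift: "\<And>z n. n \<in> gauss_int \<Longrightarrow> F (z + n) = F z + plane_linear a b n"
    using torus_map_lift [OF f] by blast
  \<comment> \<open>averaged coordinates, in which the involution becomes the translation by \<open>v / 2\<close>\<close>
  define y where "y z = (z + T z) / 2" for z
  have cont_y: "continuous_on UNIV y"
    unfolding y_def by (intro continuous_intros T) simp
  have y_shift: "y (z + n) = y z + n" if "n \<in> gauss_int" for z n
    using T_shift [OF that, of z] by (simp add: y_def field_simps)
  have y_T: "y (T z) = y z + v / 2" for z
    using TT [of z] by (simp add: y_def field_simps)
  \<comment> \<open>a coordinate in which \<open>v\<close> is odd\<close>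
  obtain r :: "complex \<Rightarrow> real" where r: "r = Re \<or> r = Im" "r v / 2 \<notin> \<int>"
    using v(2) by (auto simp: gauss_int_def)
  have r_add: "r (w + z) = r w + r z" and r_half: "r (z / 2) = r z / 2" for w z
    using r(1) by auto
  have r_Ints: "r n \<in> \<int>" if "n \<in> gauss_int" for n
    using r(1) that by (auto simp: gauss_int_def)
  \<comment> \<open>a map to the circle, periodic under deck translations, on which the involution acts as \<open>- 1\<close>\<close>
  define u where "u z = cis (2 * pi * r (y z))" for z
  have "continuous_on UNIV (\<lambda>z. r (y z))"
    using r(1) by (auto intro: continuous_intros cont_y)
  then have cont_u: "continuous_on UNIV u"
    unfolding u_def by (intro continuous_intros)
  have u_T: "u (T z) = - u z" for z
    using cis_antiperiodic [OF r_Ints [OF v(1)] r(2)] by (simp add: u_def y_T r_add r_half)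
  have u_shift: "u (z + n) = u z" if "n \<in> gauss_int" for z n
    using r_Ints [OF that] by (simp add: u_def y_shift [OF that] r_add cis_eq_iff_Ints)
  \<comment> \<open>The linear term has the matrix of \<open>f\<close> and moves by the half-integral vector \<open>plane_linear a b v / 2\<close>
      under the involution. If this vector is integral, the small odd term \<open>u z / 8\<close> still
      separates the two points.\<close>
  define G where "G z = plane_linear a b (y z) + u z / 8" for z
  have G_T: "G (T z) - G z = plane_linear a b v / 2 - u z / 4" for z
    using plane_linear_scaleR [of a b "1 / 2" v]
    by (simp add: G_def y_T plane_linear_add u_T scaleR_conv_of_real)
  \<comment> \<open>\<open>F\<close> and \<open>G\<close> have the same matrix, so their difference lives on the torus and \<open>f\<close> can be deformed
      to the map covered by \<open>G\<close>\<close>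
  have "continuous_on UNIV (\<lambda>z. G z - F z)"
    unfolding G_def by (intro continuous_intros cont_y cont_u F) simp
  moreover have "G (z + n) - F (z + n) = G z - F z" if "n \<in> gauss_int" for z n
    using that by (simp add: G_def y_shift plane_linear_add u_shift F_shift)
  ultimately obtain D where D: "continuous_map torus euclidean D"
      "\<And>z. D (torus_cover z) = G z - F z"
    using periodic_map_descends [of "\<lambda>z. G z - F z"] by blast
  define g where "g p = (fst (f p) * cis (2 * pi * Re (D p)), snd (f p) * cis (2 * pi * Im (D p)))" for p
  have homotopic: "homotopic_with (\<lambda>_. True) torus torus f g"
    unfolding g_def using torus_map_homotopic_translate [OF f D(1)] .
  then have "g \<in> \<beta>" by (simp add: \<beta> homotopy_rel_def)
  moreover have "continuous_map torus torus g"
    using homotopic homotopic_with_imp_continuous_maps by blast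
  moreover have "g (\<tau> p) \<noteq> g p" if p: "p \<in> topspace torus" for p
  proof -
    have g: "g (torus_cover z) = torus_cover (G z)" for z
      unfolding g_def D(2) F(2) [symmetric] by (simp add: torus_cover_def cis_mult algebra_simps)
    obtain z where z: "p = torus_cover z" using p by (metis torus_cover_surj)
    have "G (T z) - G z \<notin> gauss_int"
      unfolding G_T by (intro half_gauss_int_minus_small plane_linear_gauss_int ab v(1))
         (simp add: u_def)
    then show ?thesis
      by (simp add: z g torus_cover_eq_iff flip: T(2))
  qed
  ultimately show ?thesis
    by (auto simp: Borsuk_Ulam_property_def)
qed

end
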